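(* Let $p\in(0,1)$, and let $G$ and $H$ be two independent Erdős–Rényi graphs $G(n,p)$. For a positive integer $k$ let $Z_k$ be the number of $k$-cliques in $G\times H$. Then there exists a non-negative sequence $(a_n)$ with $a_n=o(1)$ such that $k^*=k^*_n=(2+a_n)\log_{1/p} n$ is a positive integer and $$\mathbb{P}(Z_{k^*}>0)\to 0\quad\text{as } n\to\infty.$$
   Context: An Erdős–Rényi graph $G(n,p)$ is a random simple graph on vertex set $\{1,\dots,n\}$ in which each of the $\binom{n}{2}$ possible edges is present independently with probability $p$. A $k$-clique is a set of $k$ pairwise adjacent vertices. The tensor product $G\times H$ of graphs $G=(V_1,E_1)$, $H=(V_2,E_2)$ has vertex set $V_1\times V_2$, with $(v_1,v_2)$ adjacent to $(v_1',v_2')$ if and only if $v_1v_1'\in E_1$ and $v_2v_2'\in E_2$. *)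

theory Defs
  imports
    "HOL-Probability.Probability"
    "HOL-Library.Ramsey"
    "HOL-Library.Landau_Symbols"
begin

text \<open>
  A simple graph is a pair of its vertex set and its edge set, an edge being a two-element set of
  vertices. The notation \<open>[V]\<^bsup>k\<^esup>\<close> for the \<open>k\<close>-element subsets of \<open>V\<close> and the predicate
  \<^const>\<open>clique\<close> are those of \<^theory>\<open>HOL-Library.Ramsey\<close>.
\<close>

type_synonym 'a graph = "'a set \<times> 'a set set"

abbreviation vertices :: "'a graph \<Rightarrow> 'a set" where
  "vertices \<equiv> fst"

abbreviation edges :: "'a graph \<Rightarrow> 'a set set" where
  "edges \<equiv> snd"

definition simple_graph :: "'a graph \<Rightarrow> bool" where
  "simple_graph G \<longleftrightarrow> edges G \<subseteq> [vertices G]\<^bsup>2\<^esup>"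

definition tensor_product :: "'a graph \<Rightarrow> 'b graph \<Rightarrow> ('a \<times> 'b) graph" where
  "tensor_product G H =
     (vertices G \<times> vertices H,
      {{(v1, v2), (w1, w2)} | v1 v2 w1 w2. {v1, w1} \<in> edges G \<and> {v2, w2} \<in> edges H})"

definition num_cliques :: "nat \<Rightarrow> 'a graph \<Rightarrow> nat" where
  "num_cliques k G = card {K \<in> [vertices G]\<^bsup>k\<^esup>. clique K (edges G)}"

text \<open>
  The independent indicators of the possible edges are a product of Bernoulli distributions;
  the value \<^term>\<open>False\<close> is the default outside the set of possible edges.
\<close>

definition erdos_renyi :: "nat \<Rightarrow> real \<Rightarrow> nat graph pmf" where
  "erdos_renyi n p =
     map_pmf (\<lambda>X. ({1..n}, {e \<in> [{1..n}]\<^bsup>2\<^esup>. X e}))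
       (Pi_pmf ([{1..n}]\<^bsup>2\<^esup>) False (\<lambda>_. bernoulli_pmf p))"

lemma tensor_product_adjacent_iff:
  "{(v1, v2), (w1, w2)} \<in> edges (tensor_product G H) \<longleftrightarrow>
     {v1, w1} \<in> edges G \<and> {v2, w2} \<in> edges H"
  unfolding tensor_product_def by (auto simp: doubleton_eq_iff insert_commute)

lemma simple_graph_tensor_product:
  assumes "simple_graph G" and "simple_graph H"
  shows "simple_graph (tensor_product G H)"
  using assms unfolding simple_graph_def tensor_product_def nsets_def
  by (fastforce simp: card_insert_if)

lemma simple_graph_erdos_renyi:
  "G \<in> set_pmf (erdos_renyi n p) \<Longrightarrow> simple_graph G"
  by (auto simp: erdos_renyi_def simple_graph_def)

end

theory Submission
  imports Defs
begin

text \<open>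
  The first projection maps a clique of \<open>G \<times> H\<close> injectively onto a clique of \<open>G\<close>, so it suffices
  that \<open>G\<close> alone contains no \<open>k\<close>-clique. For \<open>k = \<lceil>2 log n\<rceil> + 1\<close> (logarithm to base \<open>1 / p\<close>) we
  have \<open>n p ^ ((k - 1) / 2) \<le> 1\<close>, hence the expected number of \<open>k\<close>-cliques of \<open>G\<close> is at most
  \<open>(n p ^ ((k - 1) / 2)) ^ k / k! \<le> 1 / k!\<close>, which tends to \<open>0\<close>.
\<close>

text \<open>Finiteness matters because \<open>card\<close> is 0 on infinite sets.\<close>

lemma num_cliques_pos_iff:
  assumes "finite (vertices G)"
  shows "0 < num_cliques k G \<longleftrightarrow> (\<exists>K \<in> [vertices G]\<^bsup>k\<^esup>. clique K (edges G))"
  using assms by (auto simp: num_cliques_def card_gt_0_iff finite_imp_finite_nsets)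

text \<open>Adjacency in the product forces adjacency of the first coordinates. Two distinct clique
  vertices sharing a first coordinate would thus yield a singleton edge, that is a loop, which
  \<open>simple_graph\<close> excludes.\<close>

lemma clique_fst_tensor_product:
  assumes "simple_graph G" and K: "clique K (edges (tensor_product G H))"
  shows "inj_on fst K" and "clique (fst ` K) (edges G)"
proof -
  have edge: "{fst x, fst y} \<in> edges G" if "x \<in> K" "y \<in> K" "x \<noteq> y" for x y
    using K that tensor_product_adjacent_iff[of "fst x" "snd x" "fst y" "snd y" G H]
    by (auto simp: clique_def)
  show "inj_on fst K"
  proof (rule inj_onI, rule ccontr)
    fix x y assume xy: "x \<in> K" "y \<in> K" "fst x = fst y" "x \<noteq> y"
    then have "{fst x} \<in> edges G"
      using edge[of x y] by simp
    then show False
      using assms(1) by (auto simp: simple_graph_def nsets_def)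
  qed
  show "clique (fst ` K) (edges G)"
    using edge by (fastforce simp: clique_def)
qed

lemma num_cliques_tensor_product_pos:
  assumes G: "simple_graph G" "finite (vertices G)" and pos: "0 < num_cliques k (tensor_product G H)"
  shows "0 < num_cliques k G"
proof -
  from pos obtain K where K: "K \<in> [vertices G \<times> vertices H]\<^bsup>k\<^esup>"
      "clique K (edges (tensor_product G H))"
    unfolding num_cliques_def card_gt_0_iff by (auto simp: tensor_product_def)
  note fstK = clique_fst_tensor_product[OF G(1) K(2)]
  have "fst ` K \<in> [vertices G]\<^bsup>k\<^esup>"
    using K(1) fstK(1) by (auto simp: nsets_def card_image)
  with fstK(2) G(2) show ?thesis
    by (auto simp: num_cliques_pos_iff)
qed

lemma vertices_erdos_renyi: "G \<in> set_pmf (erdos_renyi n p) \<Longrightarrow> vertices G = {1..n}"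
  by (auto simp: erdos_renyi_def)

text \<open>The pairs inside \<open>K\<close> are \<open>k choose 2\<close> of the independent
  indicators, and \<open>K\<close> is a clique exactly when all of them are
  \<open>True\<close>.\<close>

lemma prob_erdos_renyi_clique:
  assumes "0 \<le> p" "p \<le> 1" and K: "K \<in> [{1..n}]\<^bsup>k\<^esup>"
  shows "measure_pmf.prob (erdos_renyi n p) {G. clique K (edges G)} = p ^ (k choose 2)"
proof -
  let ?E = "[{1..n}]\<^bsup>2\<^esup>"
  have fin: "finite ?E"
    by (simp add: finite_imp_finite_nsets)
  have sub: "[K]\<^bsup>2\<^esup> \<subseteq> ?E"
    using K by (auto simp: nsets_def)
  have card: "card ([K]\<^bsup>2\<^esup>) = k choose 2"
    using K by (simp only: card_nsets) (simp add: nsets_def)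
  have clique_iff: "clique K {e \<in> ?E. X e} \<longleftrightarrow> (\<forall>e \<in> [K]\<^bsup>2\<^esup>. X e)" for X
  proof
    assume "clique K {e \<in> ?E. X e}"
    then show "\<forall>e \<in> [K]\<^bsup>2\<^esup>. X e"
      by (auto simp: clique_def nsets_def card_2_iff)
  next
    assume X: "\<forall>e \<in> [K]\<^bsup>2\<^esup>. X e"
    have "{v, w} \<in> [K]\<^bsup>2\<^esup>" if "v \<in> K" "w \<in> K" "v \<noteq> w" for v w
      using that by (auto simp: nsets_def)
    with X sub show "clique K {e \<in> ?E. X e}"
      unfolding clique_def by blast
  qed
  \<comment> \<open>The clique event is written as a box, constrained on the pairs inside
    \<open>K\<close> and free elsewhere, so that the product measure factorises over the
    coordinates.\<close>
  let ?B = "\<lambda>e. if e \<in> [K]\<^bsup>2\<^esup> then {True} else UNIV"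
  have "measure_pmf.prob (erdos_renyi n p) {G. clique K (edges G)}
      = measure_pmf.prob (Pi_pmf ?E False (\<lambda>_. bernoulli_pmf p)) (Pi ?E ?B)"
    unfolding erdos_renyi_def measure_map_pmf
    using sub by (intro arg_cong2[where f = measure]) (auto simp: vimage_def clique_iff Pi_def simp del: One_nat_def)
  also have "\<dots> = (\<Prod>e\<in>?E. measure_pmf.prob (bernoulli_pmf p) (?B e))"
    by (rule measure_Pi_pmf_Pi[OF fin])
  also have "\<dots> = (\<Prod>e\<in>?E. if e \<in> [K]\<^bsup>2\<^esup> then p else 1)"
    using assms(1,2) by (intro prod.cong) (auto simp: measure_pmf_single)
  also have "\<dots> = p ^ (k choose 2)"
    using fin sub card by (simp add: prod.If_cases Int_absorb1 Collect_mem_eq)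
  finally show ?thesis .
qed

text \<open>Union bound over all candidate vertex sets of size \<open>k\<close>.\<close>

lemma prob_erdos_renyi_num_cliques_pos_le:
  assumes "0 \<le> p" "p \<le> 1"
  shows "measure_pmf.prob (erdos_renyi n p) {G. 0 < num_cliques k G}
    \<le> real (n choose k) * p ^ (k choose 2)"
proof -
  let ?M = "erdos_renyi n p" and ?S = "[{1..n}]\<^bsup>k\<^esup>"
  have "measure_pmf.prob ?M {G. 0 < num_cliques k G}
      \<le> measure_pmf.prob ?M (\<Union>K\<in>?S. {G. clique K (edges G)})"
    \<comment> \<open>The inclusion of events is claimed only on the support, where the vertex set
      is \<open>{1..n}\<close>.\<close>
    by (intro measure_pmf.finite_measure_mono_AE)
       (auto simp: AE_measure_pmf_iff num_cliques_pos_iff vertices_erdos_renyi)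
  also have "\<dots> \<le> (\<Sum>K\<in>?S. measure_pmf.prob ?M {G. clique K (edges G)})"
    by (intro measure_pmf.finite_measure_subadditive_finite) (auto simp: finite_imp_finite_nsets)
  also have "\<dots> = real (n choose k) * p ^ (k choose 2)"
    using assms by (simp add: prob_erdos_renyi_clique card_nsets)
  finally show ?thesis .
qed

text \<open>The event implies one about \<open>G\<close> alone, and the first marginal of the pair
  is again \<open>erdos_renyi n p\<close>.\<close>

lemma prob_num_cliques_tensor_product_le:
  assumes "0 \<le> p" "p \<le> 1"
  shows "measure_pmf.prob (pair_pmf (erdos_renyi n p) (erdos_renyi n p))
      {(G, H). 0 < num_cliques k (tensor_product G H)} \<le> real (n choose k) * p ^ (k choose 2)"
proof -
  let ?M = "erdos_renyi n p"
  have "0 < num_cliques k G"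
    if "G \<in> set_pmf ?M" "0 < num_cliques k (tensor_product G H)" for G H :: "nat graph"
    using that by (intro num_cliques_tensor_product_pos[of G k H])
      (auto simp: simple_graph_erdos_renyi vertices_erdos_renyi)
  then have "measure_pmf.prob (pair_pmf ?M ?M) {(G, H). 0 < num_cliques k (tensor_product G H)}
      \<le> measure_pmf.prob (pair_pmf ?M ?M) (fst -` {G. 0 < num_cliques k G})"
    by (intro measure_pmf.finite_measure_mono_AE)
       (auto simp: AE_measure_pmf_iff)
  also have "\<dots> = measure_pmf.prob ?M {G. 0 < num_cliques k G}"
    by (metis map_fst_pair_pmf measure_map_pmf)
  also have "\<dots> \<le> real (n choose k) * p ^ (k choose 2)"
    by (rule prob_erdos_renyi_num_cliques_pos_le[OF assms])
  finally show ?thesis .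
qed

text \<open>The bound on \<open>k\<close> amounts to \<open>p ^ (k - 1)\<close> being at most the
  inverse square of \<open>n\<close>. The factor \<open>1 / fact k\<close> comes from comparing the
  binomial coefficient with \<open>n ^ k\<close>.\<close>

lemma binomial_mult_power_le:
  fixes p :: real
  assumes p: "0 < p" "p < 1" and "0 < n" and k: "2 * log (1 / p) (real n) + 1 \<le> real k"
  shows "real (n choose k) * p ^ (k choose 2) \<le> 1 / fact k"
proof -
  let ?L = "log (1 / p) (real n)"
  have "0 \<le> ?L"
    using assms by (intro zero_le_log_cancel_iff[THEN iffD2]) auto
  \<comment> \<open>Ensures that the truncated \<open>k - 1\<close> agrees with the real
    difference.\<close>
  then have "1 \<le> k"
    using k by linarith
  have n: "real n = (1 / p) powr ?L"
    using assms by simp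
  have "p ^ (k - 1) = p powr real (k - 1)"
    using p by (simp add: powr_realpow)
  also have "\<dots> \<le> p powr (2 * ?L)"
    using p k \<open>1 \<le> k\<close> by (intro powr_mono') (auto simp: of_nat_diff)
  finally have "p ^ (k - 1) \<le> p powr (2 * ?L)" .
  moreover have "(real n)\<^sup>2 * p powr (2 * ?L) = 1"
  proof -
    have "(real n)\<^sup>2 = (1 / p) powr (?L + ?L)"
      unfolding powr_add using n by (simp only: power2_eq_square)
    then have "(real n)\<^sup>2 = (1 / p) powr (2 * ?L)"
      by (simp only: mult_2)
    moreover have "(1 / p) powr (2 * ?L) * p powr (2 * ?L) = 1"
      using p by (simp flip: powr_mult)
    ultimately show ?thesis
      by (simp only:)
  qed
  ultimately have base: "(real n)\<^sup>2 * p ^ (k - 1) \<le> 1"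
    using mult_left_mono[of "p ^ (k - 1)" "p powr (2 * ?L)" "(real n)\<^sup>2"] by simp
  \<comment> \<open>Squaring turns the exponent \<open>k choose 2\<close> into
    \<open>(k - 1) * k\<close>, so the half-integer exponent \<open>(k - 1) / 2\<close> never
    appears.\<close>
  have "(real n ^ k * p ^ (k choose 2))\<^sup>2 = ((real n)\<^sup>2 * p ^ (k - 1)) ^ k"
  proof -
    have "(k choose 2) * 2 = (k - 1) * k"
      by (cases k) (auto simp: choose_two mult.commute)
    then show ?thesis
      by (simp add: power_mult_distrib mult.commute flip: power_mult)
  qed
  also have "\<dots> \<le> 1"
    using base p by (intro power_le_one) auto
  finally have main: "real n ^ k * p ^ (k choose 2) \<le> 1"
    using power2_le_imp_le[of "real n ^ k * p ^ (k choose 2)" 1] by simp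
  have "real (n choose k) * fact k \<le> real n ^ k"
    using binomial_fact_pow[of n k] by (metis of_nat_fact of_nat_le_iff of_nat_mult of_nat_power)
  then have "real (n choose k) * fact k * p ^ (k choose 2) \<le> real n ^ k * p ^ (k choose 2)"
    using p by (intro mult_right_mono) auto
  also note main
  finally show ?thesis
    by (simp add: field_simps)
qed

theorem theorem3p1:
  fixes p :: real
  assumes "0 < p" and "p < 1"
  shows "\<exists>(a :: nat \<Rightarrow> real) (k :: nat \<Rightarrow> nat).
    (\<forall>n. 0 \<le> a n) \<and>
    a \<in> o(\<lambda>_. 1) \<and>
    (\<forall>n\<ge>2. 0 < k n \<and> real (k n) = (2 + a n) * log (1 / p) (real n)) \<and>
    (\<lambda>n. measure_pmf.prob (pair_pmf (erdos_renyi n p) (erdos_renyi n p))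
           {(G, H). num_cliques (k n) (tensor_product G H) > 0}) \<longlonglongrightarrow> 0"
proof -
  define L where "L n = log (1 / p) (real n)" for n
  \<comment> \<open>Rounding up gives an integer; the extra 1 makes up for the exponent
    \<open>k - 1\<close> in the estimate and keeps \<open>k n\<close> positive for every
    \<open>n\<close>.\<close>
  define k where "k n = nat \<lceil>2 * L n\<rceil> + 1" for n
  \<comment> \<open>Obtained by solving \<open>k n = (2 + a n) * L n\<close> for \<open>a n\<close>.
    Below 2 the logarithm \<open>L n\<close> is 0, so the value is set to 0 there.\<close>
  define a where "a n = (if n < 2 then 0 else real (k n) / L n - 2)" for n
  have L_pos: "0 < L n" if "2 \<le> n" for n
    using that assms by (auto simp: L_def)
  have k_ge: "2 * L n + 1 \<le> real (k n)" for n
    unfolding k_def by linarith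
  have k_le: "real (k n) \<le> 2 * L n + 2" if "2 \<le> n" for n
    using L_pos[OF that] unfolding k_def by linarith
  have a_nonneg: "0 \<le> a n" for n
    using L_pos[of n] k_ge[of n] by (auto simp: a_def field_simps)
  have L_lim: "filterlim L at_top at_top"
  proof -
    have "filterlim (\<lambda>n. ln (real n)) at_top at_top"
      by (rule filterlim_compose[OF ln_at_top filterlim_real_sequentially])
    then have "filterlim (\<lambda>n. (1 / ln (1 / p)) * ln (real n)) at_top at_top"
      using assms by (intro filterlim_tendsto_pos_mult_at_top[OF tendsto_const]) auto
    then show ?thesis
      by (simp add: L_def[abs_def] log_def)
  qed
  \<comment> \<open>Rounding and the added 1 raise \<open>k n\<close> above \<open>2 * L n\<close>
    by at most 2, so \<open>a n\<close> is at most \<open>2 / L n\<close>.\<close>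
  have "a \<longlonglongrightarrow> 0"
  proof (rule tendsto_sandwich[OF _ _ tendsto_const])
    show "\<forall>\<^sub>F n in sequentially. a n \<le> 2 / L n"
      using eventually_ge_at_top[of "2::nat"]
    proof eventually_elim
      case (elim n)
      have "real (k n) / L n \<le> (2 * L n + 2) / L n"
        using L_pos[OF elim] k_le[OF elim] by (intro divide_right_mono) auto
      then show ?case
        using elim L_pos[OF elim] by (simp add: a_def add_divide_distrib)
    qed
    show "(\<lambda>n. 2 / L n) \<longlonglongrightarrow> 0"
      by (rule tendsto_divide_0[OF tendsto_const filterlim_at_top_imp_at_infinity[OF L_lim]])
  qed (use a_nonneg in auto)
  then have a_small: "a \<in> o(\<lambda>_. 1)"
    by (intro smalloI_tendsto) auto
  have k_eq: "0 < k n \<and> real (k n) = (2 + a n) * L n" if "2 \<le> n" for n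
    using L_pos[OF that] that by (simp add: a_def k_def field_simps)
  \<comment> \<open>For \<open>n\<close> at least 2, \<open>k n\<close> dominates
    \<open>L n\<close>, which is unbounded.\<close>
  have k_lim: "filterlim k at_top at_top"
    unfolding filterlim_sequentially_iff_filterlim_real
    by (rule filterlim_at_top_mono[OF L_lim], rule eventually_mono[OF eventually_ge_at_top[of 2]])
       (use k_ge L_pos in \<open>smt (verit)\<close>)
  have fact_lim: "(\<lambda>n. 1 / fact (k n) :: real) \<longlonglongrightarrow> 0"
  proof (rule filterlim_compose[OF _ k_lim])
    show "(\<lambda>m. 1 / fact m :: real) \<longlonglongrightarrow> 0"
      \<comment> \<open>The numbers \<open>1 / fact m\<close> are the terms of the convergent
        exponential series at 1.\<close>
      using summable_LIMSEQ_zero[OF summable_exp[of "1::real"]] by (simp add: inverse_eq_divide)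
  qed
  have "(\<lambda>n. measure_pmf.prob (pair_pmf (erdos_renyi n p) (erdos_renyi n p))
      {(G, H). num_cliques (k n) (tensor_product G H) > 0}) \<longlonglongrightarrow> 0"
  proof (rule tendsto_sandwich[OF _ _ tendsto_const fact_lim])
    show "\<forall>\<^sub>F n in sequentially. measure_pmf.prob (pair_pmf (erdos_renyi n p) (erdos_renyi n p))
      {(G, H). num_cliques (k n) (tensor_product G H) > 0} \<le> 1 / fact (k n)"
      using eventually_gt_at_top[of "0::nat"]
    proof eventually_elim
      case (elim n)
      have "real (n choose k n) * p ^ (k n choose 2) \<le> 1 / fact (k n)"
        using assms elim k_ge[of n] by (intro binomial_mult_power_le) (auto simp: L_def)
      then show ?case
        using prob_num_cliques_tensor_product_le[of p n "k n"] assms by linarith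
    qed
  qed auto
  with a_nonneg a_small k_eq show ?thesis
    unfolding L_def by blast
qed

end
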